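(* Let $A$ be a cyclically amenable Banach algebra with a bounded approximate identity, and let $n\ge 2$. Then $M_n(A)$ is a zero Lie product determined Banach algebra.
   Context: Banach algebras are complex; $A^*$ is the dual space of $A$, which is a Banach $A$-bimodule via $(a\cdot f)(c)=f(ca)$, $(f\cdot a)(c)=f(ac)$ for $a,c\in A$, $f\in A^*$. A derivation $D\colon A\to A^*$ is a linear map with $D(ab)=D(a)\cdot b+a\cdot D(b)$ for all $a,b\in A$; it is inner if there is $\omega\in A^*$ with $D(a)=a\cdot\omega-\omega\cdot a$ for all $a\in A$; it is cyclic if $D(a)(b)=-D(b)(a)$ for all $a,b\in A$. $A$ is cyclically amenable if every continuous cyclic derivation $D\colon A\to A^*$ is inner. Approximate identities are two-sided. $M_n(A)$ is the Banach algebra of $n\times n$ matrices with entries in $A$ (with any algebra norm inducing the topology of entrywise convergence, e.g. $\|(a_{ij})\|=\max_i\sum_j\|a_{ij}\|$). A Banach algebra $B$ is a zero Lie product determined Banach algebra if for every continuous bilinear functional $\varphi\colon B\times B\to\mathbb{C}$ satisfying $\varphi(a,b)=0$ whenever $a,b\in B$ and $ab=ba$, there exists $\omega\in B^*$ such that $\varphi(a,b)=\omega(ab-ba)$ for all $a,b\in B$. *)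

theory Defs
  imports "HOL-Analysis.Analysis"
begin

section \<open>Complex Banach algebras\<close>

text \<open>Banach algebras are complex and need not be unital. The real structure of the library
  classes is required to be the restriction of the complex one.\<close>

class complex_banach_algebra = real_normed_algebra + banach +
  fixes scaleC :: "complex \<Rightarrow> 'a \<Rightarrow> 'a"  (infixr "*\<^sub>C" 75)
  assumes scaleC_add_right: "c *\<^sub>C (x + y) = c *\<^sub>C x + c *\<^sub>C y"
    and scaleC_add_left: "(c + d) *\<^sub>C x = c *\<^sub>C x + d *\<^sub>C x"
    and scaleC_scaleC: "c *\<^sub>C d *\<^sub>C x = (c * d) *\<^sub>C x"
    and scaleC_one: "1 *\<^sub>C x = x"
    and scaleR_scaleC: "r *\<^sub>R x = complex_of_real r *\<^sub>C x"
    and mult_scaleC_left: "(c *\<^sub>C x) * y = c *\<^sub>C (x * y)"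
    and mult_scaleC_right: "x * (c *\<^sub>C y) = c *\<^sub>C (x * y)"
    and norm_scaleC: "norm (c *\<^sub>C x) = cmod c * norm x"

text \<open>Complex-linear functionals; \<^const>\<open>Vector_Spaces.linear\<close> also asks that both scalar
  multiplications give vector spaces, which holds here.\<close>

abbreviation clinear_functional :: "('a::complex_banach_algebra \<Rightarrow> complex) \<Rightarrow> bool" where
  "clinear_functional \<equiv> Vector_Spaces.linear (*\<^sub>C) (*)"

lemma vector_space_scaleC:
  "vector_space ((*\<^sub>C) :: complex \<Rightarrow> 'a::complex_banach_algebra \<Rightarrow> 'a)"
  by unfold_locales (simp_all add: scaleC_add_right scaleC_add_left scaleC_scaleC scaleC_one)

lemma clinear_functional_iff:
  "clinear_functional f \<longleftrightarrow> (\<forall>x y. f (x + y) = f x + f y) \<and> (\<forall>c x. f (c *\<^sub>C x) = c * f x)"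
proof -
  have "vector_space ((*) :: complex \<Rightarrow> complex \<Rightarrow> complex)"
    by unfold_locales (simp_all add: algebra_simps)
  then show ?thesis
    using vector_space_scaleC by (auto simp: Vector_Spaces.linear_iff)
qed


section \<open>The dual bimodule and derivations into it\<close>

text \<open>The dual space consists of the complex-linear elements of the space of bounded real-linear
  maps into the complex numbers, with the operator norm of the latter.\<close>

definition cdual :: "('a::complex_banach_algebra \<Rightarrow>\<^sub>L complex) set" where
  "cdual = {f. clinear_functional (blinfun_apply f)}"

definition dual_lact ::
  "'a::complex_banach_algebra \<Rightarrow> ('a \<Rightarrow>\<^sub>L complex) \<Rightarrow> ('a \<Rightarrow>\<^sub>L complex)"  (infixr "\<rightharpoonup>" 75) where
  "a \<rightharpoonup> f = f o\<^sub>L blinfun_mult_left a"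

definition dual_ract ::
  "('a::complex_banach_algebra \<Rightarrow>\<^sub>L complex) \<Rightarrow> 'a \<Rightarrow> ('a \<Rightarrow>\<^sub>L complex)"  (infixl "\<leftharpoonup>" 75) where
  "f \<leftharpoonup> a = f o\<^sub>L blinfun_mult_right a"

lemma dual_lact_apply: "blinfun_apply (a \<rightharpoonup> f) c = blinfun_apply f (c * a)"
  by (simp add: dual_lact_def)

lemma dual_ract_apply: "blinfun_apply (f \<leftharpoonup> a) c = blinfun_apply f (a * c)"
  by (simp add: dual_ract_def)

text \<open>Complex linearity of \<open>D\<close> is stated pointwise, the vector space operations of the dual space
  being pointwise.\<close>

definition dual_derivation :: "('a::complex_banach_algebra \<Rightarrow> 'a \<Rightarrow>\<^sub>L complex) \<Rightarrow> bool" where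
  "dual_derivation D \<longleftrightarrow>
     range D \<subseteq> cdual \<and>
     (\<forall>c. clinear_functional (\<lambda>a. blinfun_apply (D a) c)) \<and>
     (\<forall>a b. D (a * b) = D a \<leftharpoonup> b + a \<rightharpoonup> D b)"

definition inner_dual_derivation :: "('a::complex_banach_algebra \<Rightarrow> 'a \<Rightarrow>\<^sub>L complex) \<Rightarrow> bool" where
  "inner_dual_derivation D \<longleftrightarrow> (\<exists>\<omega>\<in>cdual. \<forall>a. D a = a \<rightharpoonup> \<omega> - \<omega> \<leftharpoonup> a)"

definition cyclic :: "('a::complex_banach_algebra \<Rightarrow> 'a \<Rightarrow>\<^sub>L complex) \<Rightarrow> bool" where
  "cyclic D \<longleftrightarrow> (\<forall>a b. blinfun_apply (D a) b = - blinfun_apply (D b) a)"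

definition cyclically_amenable :: "'a::complex_banach_algebra itself \<Rightarrow> bool" where
  "cyclically_amenable _ \<longleftrightarrow>
     (\<forall>D :: 'a \<Rightarrow> 'a \<Rightarrow>\<^sub>L complex.
        dual_derivation D \<and> cyclic D \<and> continuous_on UNIV D \<longrightarrow> inner_dual_derivation D)"


section \<open>Bounded approximate identities\<close>

definition directed_on :: "'i set \<Rightarrow> 'i rel \<Rightarrow> bool" where
  "directed_on I r \<longleftrightarrow>
     I \<noteq> {} \<and> preorder_on I r \<and> (\<forall>i\<in>I. \<forall>j\<in>I. \<exists>k\<in>I. (i, k) \<in> r \<and> (j, k) \<in> r)"

text \<open>The filter of tails of a directed set; convergence along it is convergence of nets.\<close>

definition tails :: "'i set \<Rightarrow> 'i rel \<Rightarrow> 'i filter" where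
  "tails I r = (INF i\<in>I. principal {j \<in> I. (i, j) \<in> r})"

definition bounded_approximate_identity ::
  "'i set \<Rightarrow> 'i rel \<Rightarrow> ('i \<Rightarrow> 'a::complex_banach_algebra) \<Rightarrow> bool" where
  "bounded_approximate_identity I r e \<longleftrightarrow>
     directed_on I r \<and>
     bounded (e ` I) \<and>
     (\<forall>a. ((\<lambda>i. e i * a) \<longlongrightarrow> a) (tails I r) \<and> ((\<lambda>i. a * e i) \<longlongrightarrow> a) (tails I r))"

lemma eventually_tails:
  assumes "directed_on I r"
  shows "eventually P (tails I r) \<longleftrightarrow> (\<exists>i\<in>I. \<forall>j\<in>I. (i, j) \<in> r \<longrightarrow> P j)"
proof -
  have "\<exists>k\<in>I. principal {x \<in> I. (k, x) \<in> r}
              \<le> inf (principal {x \<in> I. (i, x) \<in> r}) (principal {x \<in> I. (j, x) \<in> r})"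
    if ij: "i \<in> I" "j \<in> I" for i j
  proof -
    from assms ij obtain k where k: "k \<in> I" "(i, k) \<in> r" "(j, k) \<in> r"
      unfolding directed_on_def by blast
    moreover have "trans r"
      using assms by (simp add: directed_on_def preorder_on_def)
    ultimately have "{x \<in> I. (k, x) \<in> r} \<subseteq> {x \<in> I. (i, x) \<in> r} \<inter> {x \<in> I. (j, x) \<in> r}"
      by (blast dest: transD)
    with k(1) show ?thesis by auto
  qed
  moreover have "I \<noteq> {}"
    using assms by (simp add: directed_on_def)
  ultimately show ?thesis
    unfolding tails_def
    by (subst eventually_INF_base) (auto simp: eventually_principal)
qed


section \<open>Zero Lie product determined Banach algebras\<close>

definition zero_Lie_product_determined :: "'b::complex_banach_algebra itself \<Rightarrow> bool" where
  "zero_Lie_product_determined _ \<longleftrightarrow>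
     (\<forall>\<phi> :: 'b \<Rightarrow> 'b \<Rightarrow> complex.
        (\<forall>a. clinear_functional (\<phi> a)) \<and> (\<forall>b. clinear_functional (\<lambda>a. \<phi> a b)) \<and>
        continuous_on UNIV (\<lambda>(a, b). \<phi> a b) \<and>
        (\<forall>a b. a * b = b * a \<longrightarrow> \<phi> a b = 0)
        \<longrightarrow> (\<exists>\<omega>\<in>cdual. \<forall>a b. \<phi> a b = blinfun_apply \<omega> (a * b - b * a)))"


section \<open>The Banach algebra of square matrices\<close>

text \<open>A type of its own is used because multiplication on \<^typ>\<open>'a ^ 'n ^ 'n\<close> is entrywise in the
  library, and \<^const>\<open>matrix_matrix_mult\<close> is only available for unital entries.\<close>

typedef ('a, 'n) sqmat = "UNIV :: ('a ^ 'n ^ 'n) set"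
  morphisms entries Sqmat ..

setup_lifting type_definition_sqmat

lemma sqmat_eq_iff: "A = B \<longleftrightarrow> (\<forall>i j. entries A $ i $ j = entries B $ i $ j)"
  by (metis entries_inject vec_eq_iff)

instantiation sqmat :: (complex_banach_algebra, finite) real_algebra
begin

lift_definition zero_sqmat :: "('a, 'b) sqmat" is 0 .
lift_definition plus_sqmat :: "('a, 'b) sqmat \<Rightarrow> ('a, 'b) sqmat \<Rightarrow> ('a, 'b) sqmat" is "(+)" .
lift_definition minus_sqmat :: "('a, 'b) sqmat \<Rightarrow> ('a, 'b) sqmat \<Rightarrow> ('a, 'b) sqmat" is "(-)" .
lift_definition uminus_sqmat :: "('a, 'b) sqmat \<Rightarrow> ('a, 'b) sqmat" is "uminus" .
lift_definition scaleR_sqmat :: "real \<Rightarrow> ('a, 'b) sqmat \<Rightarrow> ('a, 'b) sqmat" is "scaleR" .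
lift_definition times_sqmat :: "('a, 'b) sqmat \<Rightarrow> ('a, 'b) sqmat \<Rightarrow> ('a, 'b) sqmat"
  is "\<lambda>A B. \<chi> i j. \<Sum>k\<in>UNIV. A $ i $ k * B $ k $ j" .

instance
proof
  fix A B C :: "('a, 'b) sqmat" and r s :: real
  show "A * B * C = A * (B * C)"
  proof transfer
    fix A B C :: "'a ^ 'b ^ 'b"
    show "(\<chi> i j. \<Sum>k\<in>UNIV. (\<chi> i j. \<Sum>k\<in>UNIV. A $ i $ k * B $ k $ j) $ i $ k * C $ k $ j)
      = (\<chi> i j. \<Sum>k\<in>UNIV. A $ i $ k * (\<chi> i j. \<Sum>k\<in>UNIV. B $ i $ k * C $ k $ j) $ k $ j)"
      apply (simp add: vec_eq_iff sum_distrib_left sum_distrib_right mult.assoc)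
      apply (intro allI)
      apply (rule sum.swap)
      done
  qed
  show "(A + B) * C = A * C + B * C"
    by transfer (simp add: vec_eq_iff algebra_simps sum.distrib)
  show "A * (B + C) = A * B + A * C"
    by transfer (simp add: vec_eq_iff algebra_simps sum.distrib)
  show "r *\<^sub>R A * B = r *\<^sub>R (A * B)" "A * r *\<^sub>R B = r *\<^sub>R (A * B)"
    by (transfer; simp add: vec_eq_iff scaleR_sum_right)+
qed (transfer; simp add: algebra_simps)+

end

lemma entries_simps:
  "entries 0 = 0" "entries (A + B) = entries A + entries B"
  "entries (A - B) = entries A - entries B" "entries (- A) = - entries A"
  "entries (r *\<^sub>R A) = r *\<^sub>R entries A"
  "entries (A * B) $ i $ j = (\<Sum>k\<in>UNIV. entries A $ i $ k * entries B $ k $ j)"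
  by (transfer; simp)+

instantiation sqmat :: (complex_banach_algebra, finite) real_normed_algebra
begin

definition norm_sqmat :: "('a, 'b) sqmat \<Rightarrow> real" where
  "norm_sqmat A = (MAX i. \<Sum>j\<in>UNIV. norm (entries A $ i $ j))"

definition sgn_sqmat :: "('a, 'b) sqmat \<Rightarrow> ('a, 'b) sqmat" where
  "sgn_sqmat A = inverse (norm A) *\<^sub>R A"

definition dist_sqmat :: "('a, 'b) sqmat \<Rightarrow> ('a, 'b) sqmat \<Rightarrow> real" where
  "dist_sqmat A B = norm (A - B)"

definition uniformity_sqmat :: "(('a, 'b) sqmat \<times> ('a, 'b) sqmat) filter" where
  "uniformity_sqmat = (INF e\<in>{0<..}. principal {(A, B). dist A B < e})"

definition open_sqmat :: "('a, 'b) sqmat set \<Rightarrow> bool" where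
  "open_sqmat U \<longleftrightarrow> (\<forall>A\<in>U. eventually (\<lambda>(A', B). A' = A \<longrightarrow> B \<in> U) uniformity)"

instance
proof
  fix A B :: "('a, 'b) sqmat" and r :: real
  have row_le: "(\<Sum>j\<in>UNIV. norm (entries M $ i $ j)) \<le> norm M" for M :: "('a, 'b) sqmat" and i
    unfolding norm_sqmat_def by (rule Max_ge) auto
  have normI: "norm M \<le> c" if "\<And>i. (\<Sum>j\<in>UNIV. norm (entries M $ i $ j)) \<le> c"
    for M :: "('a, 'b) sqmat" and c
    unfolding norm_sqmat_def using that by (subst Max_le_iff) auto
  have entry_le: "norm (entries M $ i $ j) \<le> norm M" for M :: "('a, 'b) sqmat" and i j
    by (rule order_trans[OF _ row_le[of M i]]) (rule member_le_sum; simp)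
  have nonneg: "0 \<le> norm M" for M :: "('a, 'b) sqmat"
    using entry_le[of M undefined undefined] norm_ge_zero order_trans by blast
  show "norm A = 0 \<longleftrightarrow> A = 0"
  proof
    assume "norm A = 0"
    then have "entries A $ i $ j = 0" for i j
      using entry_le[of A i j] by simp
    then show "A = 0" by (simp add: sqmat_eq_iff entries_simps)
  next
    assume "A = 0"
    then show "norm A = 0" by (intro antisym nonneg normI) (simp add: entries_simps)
  qed
  show "norm (A + B) \<le> norm A + norm B"
  proof (rule normI)
    fix i
    have "(\<Sum>j\<in>UNIV. norm (entries (A + B) $ i $ j))
        \<le> (\<Sum>j\<in>UNIV. norm (entries A $ i $ j)) + (\<Sum>j\<in>UNIV. norm (entries B $ i $ j))"
      by (simp add: entries_simps sum.distrib[symmetric] sum_mono norm_triangle_ineq)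
    with row_le[of A i] row_le[of B i]
    show "(\<Sum>j\<in>UNIV. norm (entries (A + B) $ i $ j)) \<le> norm A + norm B" by linarith
  qed
  have scale_le: "norm (s *\<^sub>R M) \<le> \<bar>s\<bar> * norm M" for s and M :: "('a, 'b) sqmat"
    by (rule normI) (simp add: entries_simps sum_distrib_left[symmetric] mult_left_mono row_le)
  show "norm (r *\<^sub>R A) = \<bar>r\<bar> * norm A"
  proof (cases "r = 0")
    case True
    then show ?thesis using scale_le[of r A] nonneg[of "r *\<^sub>R A"] by simp
  next
    case False
    then have "norm A \<le> \<bar>inverse r\<bar> * norm (r *\<^sub>R A)"
      using scale_le[of "inverse r" "r *\<^sub>R A"] by simp
    then have "\<bar>r\<bar> * norm A \<le> norm (r *\<^sub>R A)"
      using False by (simp add: field_simps)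
    with scale_le[of r A] show ?thesis by simp
  qed
  show "norm (A * B) \<le> norm A * norm B"
  proof (rule normI)
    fix i
    have "(\<Sum>j\<in>UNIV. norm (entries (A * B) $ i $ j))
        \<le> (\<Sum>j\<in>UNIV. \<Sum>k\<in>UNIV. norm (entries A $ i $ k) * norm (entries B $ k $ j))"
      unfolding entries_simps
      by (intro sum_mono order_trans[OF norm_sum] norm_mult_ineq)
    also have "\<dots> = (\<Sum>k\<in>UNIV. norm (entries A $ i $ k) * (\<Sum>j\<in>UNIV. norm (entries B $ k $ j)))"
      by (subst sum.swap) (simp add: sum_distrib_left)
    also have "\<dots> \<le> (\<Sum>k\<in>UNIV. norm (entries A $ i $ k) * norm B)"
      by (intro sum_mono mult_left_mono row_le norm_ge_zero)
    also have "\<dots> \<le> norm A * norm B"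
      by (simp add: sum_distrib_right[symmetric] mult_right_mono row_le nonneg)
    finally show "(\<Sum>j\<in>UNIV. norm (entries (A * B) $ i $ j)) \<le> norm A * norm B" .
  qed
qed (simp_all add: sgn_sqmat_def dist_sqmat_def uniformity_sqmat_def open_sqmat_def)

end

lemma norm_sqmat_row_le: "(\<Sum>j\<in>UNIV. norm (entries A $ i $ j)) \<le> norm A"
  unfolding norm_sqmat_def by (rule Max_ge) auto

lemma norm_entries_le: "norm (entries A $ i $ j) \<le> norm A"
  by (rule order_trans[OF _ norm_sqmat_row_le[of A i]]) (rule member_le_sum; simp)

lemma norm_sqmat_le_sum: "norm A \<le> (\<Sum>i\<in>UNIV. \<Sum>j\<in>UNIV. norm (entries A $ i $ j))"
  unfolding norm_sqmat_def
  by (subst Max_le_iff) (auto intro!: member_le_sum sum_nonneg)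

text \<open>The norm topology is that of entrywise convergence. As
  \<^const>\<open>zero_Lie_product_determined\<close> refers to the norm only through the topology, the choice of
  the norm inducing it is immaterial.\<close>

lemma tendsto_sqmat_iff:
  "(f \<longlongrightarrow> A) F \<longleftrightarrow> (\<forall>i j. ((\<lambda>x. entries (f x) $ i $ j) \<longlongrightarrow> entries A $ i $ j) F)"
proof (intro iffI allI)
  fix i j
  assume "(f \<longlongrightarrow> A) F"
  then have "((\<lambda>x. norm (f x - A)) \<longlongrightarrow> 0) F"
    by (simp add: LIM_zero tendsto_norm_zero)
  then have "((\<lambda>x. entries (f x) $ i $ j - entries A $ i $ j) \<longlongrightarrow> 0) F"
    by (rule Lim_null_comparison[rotated])
       (use norm_entries_le[of "f _ - A" i j] in \<open>simp add: entries_simps\<close>)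
  then show "((\<lambda>x. entries (f x) $ i $ j) \<longlongrightarrow> entries A $ i $ j) F"
    by (rule LIM_zero_cancel)
next
  assume "\<forall>i j. ((\<lambda>x. entries (f x) $ i $ j) \<longlongrightarrow> entries A $ i $ j) F"
  then have "((\<lambda>x. \<Sum>i\<in>UNIV. \<Sum>j\<in>UNIV. norm (entries (f x) $ i $ j - entries A $ i $ j)) \<longlongrightarrow> 0) F"
    by (intro tendsto_null_sum tendsto_norm_zero LIM_zero) auto
  then have "((\<lambda>x. f x - A) \<longlongrightarrow> 0) F"
    by (rule Lim_null_comparison[rotated])
       (use norm_sqmat_le_sum[of "f _ - A"] in \<open>simp add: entries_simps\<close>)
  then show "(f \<longlongrightarrow> A) F" by (rule LIM_zero_cancel)
qed

instantiation sqmat :: (complex_banach_algebra, finite) complex_banach_algebra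
begin

lift_definition scaleC_sqmat :: "complex \<Rightarrow> ('a, 'b) sqmat \<Rightarrow> ('a, 'b) sqmat"
  is "\<lambda>c A. \<chi> i j. c *\<^sub>C A $ i $ j" .

instance
proof
  fix A B :: "('a, 'b) sqmat" and c d :: complex and r :: real
  have scaleC_zero: "z *\<^sub>C (0::'a) = 0" for z
    using norm_scaleC[of z "0::'a"] by simp
  have scaleC_sum: "z *\<^sub>C sum f S = (\<Sum>k\<in>S. z *\<^sub>C f k)" if "finite S"
    for z and f :: "'b \<Rightarrow> 'a" and S
    using that by induction (simp_all add: scaleC_zero scaleC_add_right)
  show "c *\<^sub>C (A + B) = c *\<^sub>C A + c *\<^sub>C B"
    by transfer (simp add: vec_eq_iff scaleC_add_right)
  show "(c + d) *\<^sub>C A = c *\<^sub>C A + d *\<^sub>C A"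
    by transfer (simp add: vec_eq_iff scaleC_add_left)
  show "c *\<^sub>C d *\<^sub>C A = (c * d) *\<^sub>C A"
    by transfer (simp add: vec_eq_iff scaleC_scaleC)
  show "1 *\<^sub>C A = A"
    by transfer (simp add: vec_eq_iff scaleC_one)
  show "r *\<^sub>R A = complex_of_real r *\<^sub>C A"
    by transfer (simp add: vec_eq_iff scaleR_scaleC)
  show "c *\<^sub>C A * B = c *\<^sub>C (A * B)" "A * c *\<^sub>C B = c *\<^sub>C (A * B)"
    by (transfer; simp add: vec_eq_iff scaleC_sum mult_scaleC_left mult_scaleC_right)+
  have entries_scaleC: "entries (c *\<^sub>C A) $ i $ j = c *\<^sub>C (entries A $ i $ j)" for i j
    by transfer simp
  have "norm (c *\<^sub>C A) = (MAX i. cmod c * (\<Sum>j\<in>UNIV. norm (entries A $ i $ j)))"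
    by (simp add: norm_sqmat_def entries_scaleC norm_scaleC sum_distrib_left)
  also have "\<dots> = cmod c * norm A"
    unfolding norm_sqmat_def
    by (subst mono_Max_commute[where f = "\<lambda>x. cmod c * x"])
       (auto simp: mono_def mult_left_mono image_image)
  finally show "norm (c *\<^sub>C A) = cmod c * norm A" .
next
  fix X :: "nat \<Rightarrow> ('a, 'b) sqmat"
  assume X: "Cauchy X"
  have "Cauchy (\<lambda>n. entries (X n) $ i $ j)" for i j
  proof (rule CauchyI)
    fix e :: real
    assume "0 < e"
    with X obtain M where "\<forall>m\<ge>M. \<forall>n\<ge>M. norm (X m - X n) < e"
      using CauchyD by blast
    moreover have "norm (entries (X m) $ i $ j - entries (X n) $ i $ j) \<le> norm (X m - X n)" for m n
      using norm_entries_le[of "X m - X n" i j] by (simp add: entries_simps)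
    ultimately show "\<exists>M. \<forall>m\<ge>M. \<forall>n\<ge>M. norm (entries (X m) $ i $ j - entries (X n) $ i $ j) < e"
      by (meson le_less_trans)
  qed
  then have "(\<lambda>n. entries (X n) $ i $ j) \<longlonglongrightarrow> lim (\<lambda>n. entries (X n) $ i $ j)" for i j
    by (simp add: Cauchy_convergent_iff convergent_LIMSEQ_iff)
  then have "X \<longlonglongrightarrow> Sqmat (\<chi> i j. lim (\<lambda>n. entries (X n) $ i $ j))"
    by (simp add: tendsto_sqmat_iff Sqmat_inverse)
  then show "convergent X" by (rule convergentI)
qed

end

end

theory Submission
  imports Defs
begin

text \<open>Let \<open>\<phi>\<close> be a bounded bilinear form on matrices over \<open>A\<close> that vanishes on commuting pairs. Such
  a form is skew-symmetric, and it is determined by its values on pairs of matrices with a single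
  nonzero entry. Write \<open>a e\<^sub>i\<^sub>j\<close> for the matrix with the entry \<open>a\<close> at the place \<open>ij\<close>. Two such
  matrices \<open>a e\<^sub>i\<^sub>j\<close> and \<open>b e\<^sub>k\<^sub>l\<close> commute unless \<open>j = k\<close> or \<open>l = i\<close>, so two kinds of values remain.

  For \<open>i \<noteq> l\<close>, the value at \<open>a e\<^sub>i\<^sub>j\<close> and \<open>b e\<^sub>j\<^sub>l\<close> should depend on \<open>a b\<close> only, since the product of
  the two matrices is \<open>a b e\<^sub>i\<^sub>l\<close>. Explicit pairs with vanishing products let a factor be moved from
  the second argument to the first at the cost of changing the inner index
  (\<open>off_diagonal_balance\<close>). With an approximate identity, the inner index becomes immaterial, and a
  form \<open>F\<close> with \<open>F(ab, c) = F(a, bc)\<close> is a bounded functional of the product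
  (\<open>balanced_form_factors\<close>). Subtracting the resulting functional of the commutator from \<open>\<phi>\<close> leaves a
  form with no such values.

  What remains is the family \<open>G\<^sub>i\<^sub>j(a, b) = \<phi>(a e\<^sub>i\<^sub>j, b e\<^sub>j\<^sub>i)\<close>, and the task is to find functionals
  \<open>f\<^sub>i\<close> with \<open>G\<^sub>i\<^sub>j(a, b) = f\<^sub>i(ab) - f\<^sub>j(ba)\<close>. Annihilating pairs of rank one matrices yield a
  four-term relation among the \<open>G\<^sub>i\<^sub>j\<close> (\<open>rank_one_relation\<close>). For a fixed index \<open>n\<close> it controls how the
  cyclic sum \<open>G\<^sub>n\<^sub>n(ab, c) + G\<^sub>n\<^sub>n(bc, a) + G\<^sub>n\<^sub>n(ca, b)\<close> changes when factors are moved between \<open>a\<close>, \<open>b\<close>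
  and \<open>c\<close>. Since \<open>a\<close> commutes with its square, the sum vanishes (\<open>cyclic_derivation_identity\<close>), so
  that \<open>G\<^sub>n\<^sub>n\<close> is a cyclic derivation. Cyclic amenability of \<open>A\<close>
  then gives \<open>f\<^sub>n\<close>. The same relation shows that \<open>G\<^sub>i\<^sub>n(a, b) + f\<^sub>n(ba)\<close> is a functional \<open>f\<^sub>i\<close> of \<open>ab\<close>,
  and, with two of its variables removed by a limit, that
  \<open>G\<^sub>i\<^sub>j = G\<^sub>i\<^sub>n + G\<^sub>n\<^sub>j - G\<^sub>n\<^sub>n\<close>, which settles all pairs of indices (\<open>diagonal_functionals\<close>).
  Amenability is thus used for \<open>A\<close> itself and not for the matrix algebra.\<close>


section \<open>Bounded functionals and bilinear forms\<close>

locale cbilinear_form = bounded_bilinear \<phi>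
  for \<phi> :: "'a::complex_banach_algebra \<Rightarrow> 'a \<Rightarrow> complex" +
  assumes scaleC_left: "\<phi> (c *\<^sub>C a) b = c * \<phi> a b"
    and scaleC_right: "\<phi> a (c *\<^sub>C b) = c * \<phi> a b"

lemma cdualE:
  assumes "\<omega> \<in> cdual"
  shows "blinfun_apply \<omega> (x + y) = blinfun_apply \<omega> x + blinfun_apply \<omega> y"
    and "blinfun_apply \<omega> (c *\<^sub>C x) = c * blinfun_apply \<omega> x"
  using assms by (simp_all add: cdual_def clinear_functional_iff)

lemma cdual_exI:
  fixes f :: "'a::complex_banach_algebra \<Rightarrow> complex"
  assumes add: "\<And>x y. f (x + y) = f x + f y"
    and scale: "\<And>c x. f (c *\<^sub>C x) = c * f x"
    and bound: "\<And>x. norm (f x) \<le> norm x * K"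
  shows "\<exists>\<omega>\<in>cdual. \<forall>x. blinfun_apply \<omega> x = f x"
proof -
  have "bounded_linear f"
    using add scale bound
    by (intro bounded_linear_intro[where K = K]) (simp_all add: scaleR_scaleC scaleR_conv_of_real)
  then have "blinfun_apply (Blinfun f) = f"
    by (rule bounded_linear_Blinfun_apply)
  then show ?thesis
    using add scale
    by (intro bexI[of _ "Blinfun f"]) (simp_all add: cdual_def clinear_functional_iff)
qed

text \<open>As in the linear case, continuity of a bilinear form at the origin gives boundedness by
  rescaling both arguments.\<close>

lemma cbilinear_formI:
  fixes \<phi> :: "'a::complex_banach_algebra \<Rightarrow> 'a \<Rightarrow> complex"
  assumes right: "\<And>a. clinear_functional (\<phi> a)"
    and left: "\<And>b. clinear_functional (\<lambda>a. \<phi> a b)"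
    and cont: "continuous_on UNIV (\<lambda>(a, b). \<phi> a b)"
  shows "cbilinear_form \<phi>"
proof -
  have add: "\<phi> (a + a') b = \<phi> a b + \<phi> a' b" "\<phi> a (b + b') = \<phi> a b + \<phi> a b'"
    and scaleC: "\<phi> (c *\<^sub>C a) b = c * \<phi> a b" "\<phi> a (c *\<^sub>C b) = c * \<phi> a b" for a a' b b' c
    using left right by (simp_all add: clinear_functional_iff)
  have scaleR: "\<phi> (r *\<^sub>R a) b = r *\<^sub>R \<phi> a b" "\<phi> a (r *\<^sub>R b) = r *\<^sub>R \<phi> a b" for r a b
    by (simp_all add: scaleC scaleR_scaleC scaleR_conv_of_real)
  have zero: "\<phi> 0 b = 0" "\<phi> a 0 = 0" for a b
    using scaleR(1)[of 0 a b for a] scaleR(2)[of a 0 b for b] by simp_all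
  from cont have "isCont (\<lambda>(a, b). \<phi> a b) (0, 0)"
    by (simp add: continuous_on_eq_continuous_at)
  then obtain d where d: "d > 0" "\<And>a b. dist (a, b) (0, 0) < d \<Longrightarrow> norm (\<phi> a b) < 1"
    unfolding continuous_at_eps_delta by (metis case_prod_conv dist_0_norm dist_commute zero(1) zero_less_one)
  have small: "norm (\<phi> a b) < 1" if "norm a < d / 2" "norm b < d / 2" for a b
  proof -
    have "norm (a, b) \<le> norm a + norm b"
      by (simp add: norm_Pair sqrt_sum_squares_le_sum)
    with that show ?thesis
      by (intro d(2)) (simp add: dist_norm zero_prod_def[symmetric])
  qed
  \<comment> \<open>Nonzero arguments are rescaled to the norm \<open>d / 4\<close>.\<close>
  have "norm (\<phi> a b) \<le> norm a * norm b * (4 / d)\<^sup>2" for a b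
  proof (cases "a = 0 \<or> b = 0")
    case True
    then show ?thesis by (auto simp: zero)
  next
    case False
    define s t where "s = d / (4 * norm a)" and "t = d / (4 * norm b)"
    have st: "s > 0" "t > 0" using False d(1) by (auto simp: s_def t_def)
    have "norm (\<phi> (s *\<^sub>R a) (t *\<^sub>R b)) < 1"
      using False d(1) by (intro small) (auto simp: s_def t_def)
    then have "s * t * norm (\<phi> a b) < 1"
      using st by (simp add: scaleR algebra_simps)
    then show ?thesis
      using False d(1) by (simp add: s_def t_def field_simps power2_eq_square)
  qed
  then show ?thesis
    by unfold_locales (use add scaleR scaleC in blast)+
qed

lemma (in cbilinear_form) skew_if_alternating:
  assumes "\<And>a. \<phi> a a = 0"
  shows "\<phi> a b = - \<phi> b a"
  using assms[of "a + b"] assms[of a] assms[of b]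
  by (simp add: add_left add_right add_eq_0_iff)

lemma (in cbilinear_form) cbilinear_form_compose:
  fixes S T :: "'b::complex_banach_algebra \<Rightarrow> 'a"
  assumes "bounded_linear S" "bounded_linear T"
    and "\<And>c x. S (c *\<^sub>C x) = c *\<^sub>C S x" "\<And>c x. T (c *\<^sub>C x) = c *\<^sub>C T x"
  shows "cbilinear_form (\<lambda>x y. \<phi> (S x) (T y))"
proof -
  interpret c: bounded_bilinear "\<lambda>x y. \<phi> (S x) (T y)"
    by (rule comp[OF assms(1,2)])
  show ?thesis
    by unfold_locales (simp_all add: assms scaleC_left scaleC_right)
qed

lemma (in cbilinear_form) cbilinear_form_plus:
  assumes "cbilinear_form \<psi>"
  shows "cbilinear_form (\<lambda>x y. \<phi> x y + \<psi> x y)"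
proof -
  interpret p: cbilinear_form \<psi> by fact
  obtain K L where "\<And>a b. norm (\<phi> a b) \<le> norm a * norm b * K"
    "\<And>a b. norm (\<psi> a b) \<le> norm a * norm b * L"
    using bounded p.bounded by blast
  then have "norm (\<phi> a b + \<psi> a b) \<le> norm a * norm b * (K + L)" for a b
    by (metis distrib_left norm_triangle_mono)
  then have "\<exists>M. \<forall>a b. norm (\<phi> a b + \<psi> a b) \<le> norm a * norm b * M"
    by blast
  then show ?thesis
    by unfold_locales
      (simp_all add: add_left add_right p.add_left p.add_right scaleC_left scaleC_right
        p.scaleC_left p.scaleC_right scaleR_left scaleR_right p.scaleR_left p.scaleR_right
        scaleR_add_right distrib_left add_ac)
qed

lemma cbilinear_form_functional_mult:
  assumes "\<omega> \<in> cdual"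
  shows "cbilinear_form (\<lambda>x y. blinfun_apply \<omega> (x * y))"
    and "cbilinear_form (\<lambda>x y. blinfun_apply \<omega> (y * x))"
proof -
  have "norm (blinfun_apply \<omega> (x * y)) \<le> norm x * norm y * norm \<omega>" for x y
    by (rule order_trans[OF norm_blinfun])
      (simp add: mult.commute mult_left_mono norm_mult_ineq)
  note bound = this
  show "cbilinear_form (\<lambda>x y. blinfun_apply \<omega> (x * y))"
    using bound
    by unfold_locales (auto simp: distrib_left distrib_right blinfun.bilinear_simps
        mult_scaleC_left mult_scaleC_right cdualE[OF assms])
  have "norm (blinfun_apply \<omega> (y * x)) \<le> norm x * norm y * norm \<omega>" for x y
    using bound[of y x] by (simp add: mult.commute)
  then show "cbilinear_form (\<lambda>x y. blinfun_apply \<omega> (y * x))"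
    by unfold_locales (auto simp: distrib_left distrib_right blinfun.bilinear_simps
        mult_scaleC_left mult_scaleC_right cdualE[OF assms])
qed

lemma cbilinear_form_uminus:
  assumes "cbilinear_form \<psi>"
  shows "cbilinear_form (\<lambda>x y. - \<psi> x y)"
proof -
  interpret p: cbilinear_form \<psi> by fact
  show ?thesis
    using p.bounded
    by unfold_locales (simp_all add: p.add_left p.add_right p.scaleC_left p.scaleC_right p.scaleR_left p.scaleR_right)
qed

section \<open>Forms on an algebra with a bounded approximate identity\<close>

text \<open>A net is represented by a nontrivial filter on its index type; the bound on the norm needs to
  hold only eventually.\<close>

locale bounded_approximate_unit =
  fixes F :: "'i filter" and e :: "'i \<Rightarrow> 'a::complex_banach_algebra" and B :: real
  assumes nontrivial: "F \<noteq> bot"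
    and norm_le: "\<forall>\<^sub>F i in F. norm (e i) \<le> B"
    and left_unit: "((\<lambda>i. e i * a) \<longlongrightarrow> a) F"
    and right_unit: "((\<lambda>i. a * e i) \<longlongrightarrow> a) F"
begin

text \<open>This is how a variable is removed from an identity: it is replaced by the approximate
  identity, and the limit of the constant expression is its value.\<close>

lemma limit_of_constant:
  fixes g :: "'a \<Rightarrow> complex"
  assumes "((\<lambda>i. g (e i)) \<longlongrightarrow> l) F" and "\<And>x. g x = c"
  shows "l = c"
  using assms tendsto_unique[OF nontrivial, of "\<lambda>_. c"] by auto

text \<open>In a unital algebra the functional would be \<open>\<phi> 1\<close>; here it is the limit of \<open>\<phi> (e i)\<close>. On a
  product \<open>b * c\<close> the limit exists and is \<open>\<phi> b c\<close>, since \<open>\<phi> (e i) (b * c) = \<phi> (e i * b) c\<close>. Every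
  \<open>c\<close> is approximated by products \<open>e j * c\<close>, and the functionals \<open>\<phi> (e i)\<close> are uniformly bounded
  eventually, so that the values \<open>\<phi> (e i) c\<close> form a Cauchy net.\<close>

lemma balanced_form_factors:
  fixes \<phi> :: "'a \<Rightarrow> 'a \<Rightarrow> complex"
  assumes "cbilinear_form \<phi>"
    and balanced: "\<And>a b c. \<phi> (a * b) c = \<phi> a (b * c)"
  shows "\<exists>\<omega>\<in>cdual. \<forall>a b. \<phi> a b = blinfun_apply \<omega> (a * b)"
proof -
  interpret cbilinear_form \<phi> by fact
  obtain K where K: "K > 0" "\<And>a b. norm (\<phi> a b) \<le> norm a * norm b * K"
    using pos_bounded by blast
  have small: "\<forall>\<^sub>F i in F. norm (\<phi> (e i) c) \<le> norm c * (B * K)" for c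
    using norm_le
  proof eventually_elim
    case (elim i)
    have "norm (\<phi> (e i) c) \<le> norm (e i) * norm c * K" by (rule K(2))
    also have "\<dots> \<le> B * norm c * K"
      using elim K(1) by (intro mult_right_mono) auto
    finally show ?case by (simp add: ac_simps)
  qed
  have prod_lim: "((\<lambda>i. \<phi> (e i) (b * c)) \<longlongrightarrow> \<phi> b c) F" for b c
    using tendsto[OF left_unit[of b] tendsto_const[of c]] by (simp add: balanced)
  have "\<exists>l. ((\<lambda>i. \<phi> (e i) c) \<longlongrightarrow> l) F" for c
  proof -
    have "cauchy_filter (filtermap (\<lambda>i. \<phi> (e i) c) F)"
      unfolding cauchy_filter_metric_filtermap
    proof (intro allI impI)
      fix \<epsilon> :: real
      assume "\<epsilon> > 0"
      have "((\<lambda>j. norm (c - e j * c) * (B * K)) \<longlongrightarrow> norm (c - c) * (B * K)) F"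
        by (intro tendsto_intros left_unit)
      then have "\<forall>\<^sub>F j in F. norm (c - e j * c) * (B * K) < \<epsilon> / 4"
        by (rule order_tendstoD) (use \<open>\<epsilon> > 0\<close> in simp)
      then obtain j where j: "norm (c - e j * c) * (B * K) < \<epsilon> / 4"
        using eventually_happens' nontrivial by blast
      define P where "P i \<longleftrightarrow> dist (\<phi> (e i) c) (\<phi> (e j) c) < \<epsilon> / 2" for i
      have "\<forall>\<^sub>F i in F. dist (\<phi> (e i) (e j * c)) (\<phi> (e j) c) < \<epsilon> / 4"
        using \<open>\<epsilon> > 0\<close> by (intro tendstoD[OF prod_lim]) simp
      then have "eventually P F"
        using small[of "c - e j * c"]
      proof eventually_elim
        case (elim i)
        have "dist (\<phi> (e i) c) (\<phi> (e i) (e j * c)) < \<epsilon> / 4"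
          using elim(2) j by (simp add: dist_norm diff_right)
        with elim(1) show "P i"
          unfolding P_def
          using dist_triangle[of "\<phi> (e i) c" "\<phi> (e j) c" "\<phi> (e i) (e j * c)"] by linarith
      qed
      moreover have "dist (\<phi> (e x) c) (\<phi> (e y) c) < \<epsilon>" if "P x" "P y" for x y
        using that dist_triangle2[of "\<phi> (e x) c" "\<phi> (e y) c" "\<phi> (e j) c"]
        unfolding P_def by linarith
      ultimately show "\<exists>P. eventually P F \<and> (\<forall>x y. P x \<and> P y \<longrightarrow> dist (\<phi> (e x) c) (\<phi> (e y) c) < \<epsilon>)"
        by blast
    qed
    then show ?thesis
      using convergent_filter_iff_cauchy[of "filtermap (\<lambda>i. \<phi> (e i) c) F"] nontrivial
      by (auto simp: convergent_filter_iff filterlim_def filtermap_bot_iff)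
  qed
  then obtain f where f: "\<And>c. ((\<lambda>i. \<phi> (e i) c) \<longlongrightarrow> f c) F"
    by metis
  have "\<exists>\<omega>\<in>cdual. \<forall>x. blinfun_apply \<omega> x = f x"
  proof (rule cdual_exI)
    show "f (x + y) = f x + f y" for x y
      using tendsto_unique[OF nontrivial f[of "x + y"]] tendsto_add[OF f[of x] f[of y]]
      by (simp add: add_right)
    show "f (c *\<^sub>C x) = c * f x" for c x
      using tendsto_unique[OF nontrivial f[of "c *\<^sub>C x"]] tendsto_mult_left[OF f[of x]]
      by (simp add: scaleC_right)
    show "norm (f x) \<le> norm x * (B * K)" for x
      using tendsto_upperbound[OF tendsto_norm[OF f] small nontrivial] .
  qed
  moreover have "\<phi> a b = f (a * b)" for a b
    using tendsto_unique[OF nontrivial f prod_lim] by simp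
  ultimately show ?thesis by metis
qed

text \<open>The sum \<open>T a b c\<close> of the three terms of the conclusion is invariant under cyclic permutations.
  The hypothesis \<open>shift\<close> says that a factor at the end of the cyclic word can be carried over to its
  beginning, so \<open>T\<close> depends on the cyclic word \<open>abcd\<close> only, however it is cut into three parts.
  The hypothesis \<open>square\<close> makes \<open>T\<close> vanish on the diagonal, hence antisymmetric. Thus \<open>T b c (x * a)\<close>
  and \<open>T c a (x * b)\<close>, which are cuts of the cyclic words \<open>bcxa\<close> and \<open>caxb\<close> that differ by an exchange of
  the parts \<open>bc\<close> and \<open>x\<close>, are opposite. As \<open>x\<close> tends to a unit, both tend to the same value
  by cyclicity, so this value is zero. The hypothesis \<open>shift\<close> alone would not do: on a commutative
  graded algebra it holds for the skew-symmetric form that is \<open>(deg a - deg b) * t (a * b)\<close> on homogeneous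
  elements, and there \<open>T a b c\<close> is \<open>deg (a * b * c) * t (a * b * c)\<close>.\<close>

lemma cyclic_derivation_identity:
  fixes \<phi> :: "'a \<Rightarrow> 'a \<Rightarrow> complex"
  assumes "cbilinear_form \<phi>"
    and skew: "\<And>a b. \<phi> a b = - \<phi> b a"
    and square: "\<And>a. \<phi> a (a * a) = 0"
    and shift: "\<And>a b c d. \<phi> (a * b) (c * d) - \<phi> a (b * c * d) = \<phi> (d * a * b) c - \<phi> (d * a) (b * c)"
  shows "\<phi> (a * b) c + \<phi> (b * c) a + \<phi> (c * a) b = 0"
proof -
  interpret cbilinear_form \<phi> by fact
  define T where "T a b c = \<phi> (a * b) c + \<phi> (b * c) a + \<phi> (c * a) b" for a b c
  have cyc: "T a b c = T b c a" for a b c by (simp add: T_def)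
  have regroup: "T (d * a) b c = T a b (c * d)" for a b c d
    using shift[of a b c d] skew[of "b * c * d" a] skew[of "b * c" "d * a"]
    by (simp add: T_def mult.assoc)
  have add: "T (a + a') b c = T a b c + T a' b c" "T a (b + b') c = T a b c + T a b' c"
    "T a b (c + c') = T a b c + T a b c'" for a a' b b' c c'
    by (simp_all add: T_def algebra_simps add_left add_right)
  have cube: "T a a a = 0" for a
    using square[of a] skew[of "a * a" a] by (simp add: T_def)
  have anti: "T a b c = - T a c b" for a b c
  proof -
    have two: "T x x y + T x y x + T y x x + (T x y y + T y x y + T y y x) = 0" for x y
      using cube[of "x + y"] cube[of x] cube[of y] by (simp add: add ac_simps)
    \<comment> \<open>Polarization: the sum of \<open>T\<close> over all permutations of its arguments vanishes, and by
      cyclicity each of the two cyclic classes occurs three times.\<close>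
    have "3 * (T a b c + T a c b) = 0"
      using two[of a b] two[of b c] two[of a c] cube[of "a + b + c"] cube[of a] cube[of b] cube[of c]
        cyc[of a b c] cyc[of b c a] cyc[of a c b] cyc[of c b a]
      apply (simp add: add)
      by algebra
    then show ?thesis by (simp add: add_eq_0_iff)
  qed
  have lim: "((\<lambda>i. T x y (z i)) \<longlongrightarrow> T x y w) F" if "(z \<longlongrightarrow> w) F" for x y z w
    unfolding T_def by (intro tendsto_intros tendsto tendsto_mult that)
  have eq: "T b c (x * a) = - T c a (x * b)" for a b c x
  proof -
    have "T b c (x * a) = T a (b * c) x"
      using regroup[of a b c x] regroup[of b c x a] cyc by metis
    moreover have "T c a (x * b) = T a x (b * c)"
      using regroup[of b c a x] cyc by metis
    ultimately show ?thesis using anti by metis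
  qed
  have "((\<lambda>i. T b c (e i * a) + T c a (e i * b)) \<longlongrightarrow> T b c a + T c a b) F"
    by (intro tendsto_add lim left_unit)
  then have "T b c a + T c a b = 0"
    by (rule limit_of_constant[where g = "\<lambda>x. T b c (x * a) + T c a (x * b)"]) (subst eq, simp)
  then have "2 * T a b c = 0"
    by (simp add: cyc[of a b c] cyc[of b c a, symmetric])
  then have "T a b c = 0" by simp
  then show ?thesis by (simp add: T_def)
qed

text \<open>The four-term relation among the block forms of a form on matrices holds for all \<open>b\<close> and \<open>d\<close>;
  the cases in which \<open>d\<close>, and then also \<open>b\<close>, is a unit are recovered one limit at a time.\<close>

lemma four_forms_limits:
  fixes P\<^sub>1 P\<^sub>2 P\<^sub>3 P\<^sub>4 :: "'a \<Rightarrow> 'a \<Rightarrow> complex"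
  assumes P: "cbilinear_form P\<^sub>1" "cbilinear_form P\<^sub>2" "cbilinear_form P\<^sub>3" "cbilinear_form P\<^sub>4"
    and rel: "\<And>a b c d. P\<^sub>1 a (b * c * d) - P\<^sub>2 (a * b) (c * d) - P\<^sub>3 (d * a) (b * c) + P\<^sub>4 (d * a * b) c = 0"
  shows "P\<^sub>1 a (b * c) - P\<^sub>2 (a * b) c - P\<^sub>3 a (b * c) + P\<^sub>4 (a * b) c = 0"
    and "P\<^sub>1 a c - P\<^sub>2 a c - P\<^sub>3 a c + P\<^sub>4 a c = 0"
proof -
  interpret p1: cbilinear_form P\<^sub>1 by fact
  interpret p2: cbilinear_form P\<^sub>2 by fact
  interpret p3: cbilinear_form P\<^sub>3 by fact
  interpret p4: cbilinear_form P\<^sub>4 by fact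
  note lims = tendsto_intros p1.tendsto p2.tendsto p3.tendsto p4.tendsto left_unit right_unit
  have rel': "P\<^sub>1 a (b * c) - P\<^sub>2 (a * b) c - P\<^sub>3 a (b * c) + P\<^sub>4 (a * b) c = 0" for a b c
  proof (rule limit_of_constant[where g = "\<lambda>d. P\<^sub>1 a (b * c * d) - P\<^sub>2 (a * b) (c * d)
      - P\<^sub>3 (d * a) (b * c) + P\<^sub>4 (d * a * b) c"])
    show "((\<lambda>i. P\<^sub>1 a (b * c * e i) - P\<^sub>2 (a * b) (c * e i) - P\<^sub>3 (e i * a) (b * c)
      + P\<^sub>4 (e i * a * b) c) \<longlongrightarrow> P\<^sub>1 a (b * c) - P\<^sub>2 (a * b) c - P\<^sub>3 a (b * c) + P\<^sub>4 (a * b) c) F"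
      by (intro lims)
  qed (rule rel)
  then show "P\<^sub>1 a (b * c) - P\<^sub>2 (a * b) c - P\<^sub>3 a (b * c) + P\<^sub>4 (a * b) c = 0" .
  show "P\<^sub>1 a c - P\<^sub>2 a c - P\<^sub>3 a c + P\<^sub>4 a c = 0"
  proof (rule limit_of_constant[where g = "\<lambda>b. P\<^sub>1 a (b * c) - P\<^sub>2 (a * b) c - P\<^sub>3 a (b * c)
      + P\<^sub>4 (a * b) c"])
    show "((\<lambda>i. P\<^sub>1 a (e i * c) - P\<^sub>2 (a * e i) c - P\<^sub>3 a (e i * c) + P\<^sub>4 (a * e i) c) \<longlongrightarrow>
      P\<^sub>1 a c - P\<^sub>2 a c - P\<^sub>3 a c + P\<^sub>4 a c) F"
      by (intro lims)
  qed (rule rel')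
qed

text \<open>The forms \<open>P\<close>, \<open>H\<close>, \<open>H'\<close>, \<open>Q\<close> stand for the blocks \<open>ii\<close>, \<open>in\<close>, \<open>ni\<close>, \<open>nn\<close>. The two limit
  relations eliminate \<open>P\<close> and \<open>H'\<close> and show that \<open>H\<close> fails to be balanced exactly as much as \<open>Q\<close>
  does. Feeding this back into the full relation eliminates \<open>H\<close> as well and leaves an identity for
  \<open>Q\<close> alone.\<close>

lemma four_forms_coupling:
  fixes P H H' Q :: "'a \<Rightarrow> 'a \<Rightarrow> complex"
  assumes forms: "cbilinear_form P" "cbilinear_form H" "cbilinear_form H'" "cbilinear_form Q"
    and skew: "\<And>a b. Q a b = - Q b a" "\<And>a b. H' a b = - H b a"
    and rel: "\<And>a b c d. P a (b * c * d) - H (a * b) (c * d) - H' (d * a) (b * c) + Q (d * a * b) c = 0"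
  shows "H (a * b) c - H a (b * c) = Q (a * b) c - Q a (b * c)"
    and "Q (a * b) (c * d) - Q a (b * c * d) = Q (d * a * b) c - Q (d * a) (b * c)"
proof -
  note lim = four_forms_limits[OF forms rel]
  have HQ: "H (a * b) c - H a (b * c) = Q (a * b) c - Q a (b * c)" for a b c
    using lim(1)[of a b c] lim(2)[of a "b * c"] by algebra
  then show "H (a * b) c - H a (b * c) = Q (a * b) c - Q a (b * c)" .
  have "P a (b * c * d) - H (a * b) (c * d) + H (b * c) (d * a) + Q (d * a * b) c = 0"
    using rel[of a b c d] skew(2)[of "d * a" "b * c"] by simp
  moreover have "P a (b * c * d) - H a (b * c * d) + H (b * c * d) a + Q a (b * c * d) = 0"
    using lim(2)[of a "b * c * d"] skew(2)[of a "b * c * d"] by simp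
  ultimately show "Q (a * b) (c * d) - Q a (b * c * d) = Q (d * a * b) c - Q (d * a) (b * c)"
    using HQ[of a b "c * d"] HQ[of "b * c" d a] skew(1)[of a "b * c * d"] skew(1)[of "d * a" "b * c"]
    unfolding mult.assoc by algebra
qed

end

text \<open>Under \<open>D a = Q a\<close>, skew-symmetric forms with this identity are the bounded cyclic derivations into the
  dual. The functional that implements \<open>D\<close> enters with the opposite sign, because
  \<open>(a \<rightharpoonup> \<omega> - \<omega> \<leftharpoonup> a) b = \<omega> (b * a) - \<omega> (a * b)\<close>.\<close>

lemma cyclically_amenable_form:
  fixes Q :: "'a::complex_banach_algebra \<Rightarrow> 'a \<Rightarrow> complex"
  assumes amenable: "cyclically_amenable TYPE('a)"
    and "cbilinear_form Q"
    and skew: "\<And>a b. Q a b = - Q b a"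
    and cyc: "\<And>a b c. Q (a * b) c + Q (b * c) a + Q (c * a) b = 0"
  shows "\<exists>f\<in>cdual. \<forall>a b. Q a b = blinfun_apply f (a * b) - blinfun_apply f (b * a)"
proof -
  interpret cbilinear_form Q by fact
  define D where "D a = Blinfun (Q a)" for a
  have D: "blinfun_apply (D a) b = Q a b" for a b
    by (simp add: D_def bounded_linear_Blinfun_apply bounded_linear_right)
  obtain K where K: "K > 0" "\<And>a b. norm (Q a b) \<le> norm a * norm b * K"
    using pos_bounded by blast
  have "norm (Q a b) \<le> norm a * K * norm b" for a b
    using K(2)[of a b] by (simp add: ac_simps)
  then have "norm (D a) \<le> norm a * K" for a
    using K(1) by (intro norm_blinfun_bound) (simp_all add: D)
  then have "bounded_linear D"
    by (intro bounded_linear_intro[where K = K] blinfun_eqI)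
      (simp_all add: D add_left scaleR_left blinfun.bilinear_simps)
  then have "continuous_on UNIV D"
    by (rule linear_continuous_on)
  moreover have "cyclic D"
    unfolding cyclic_def D using skew by blast
  moreover have "dual_derivation D"
    unfolding dual_derivation_def
  proof (intro conjI allI)
    show "range D \<subseteq> cdual"
      by (auto simp: cdual_def clinear_functional_iff D add_right scaleC_right)
    show "clinear_functional (\<lambda>a. blinfun_apply (D a) c)" for c
      by (simp add: clinear_functional_iff D add_left scaleC_left)
    have "Q (a * b) c = Q a (b * c) + Q b (c * a)" for a b c
      using cyc[of a b c] skew[of "b * c" a] skew[of "c * a" b] by (simp add: algebra_simps)
    then show "D (a * b) = D a \<leftharpoonup> b + a \<rightharpoonup> D b" for a b
      by (intro blinfun_eqI) (simp add: D dual_lact_apply dual_ract_apply blinfun.bilinear_simps)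
  qed
  ultimately obtain \<omega> where \<omega>: "\<omega> \<in> cdual" "\<And>a. D a = a \<rightharpoonup> \<omega> - \<omega> \<leftharpoonup> a"
    using amenable unfolding cyclically_amenable_def inner_dual_derivation_def by blast
  have "- \<omega> \<in> cdual"
    using \<omega>(1) by (simp add: cdual_def clinear_functional_iff blinfun.bilinear_simps)
  moreover have "Q a b = blinfun_apply (- \<omega>) (a * b) - blinfun_apply (- \<omega>) (b * a)" for a b
    using D[of a b] by (simp add: \<omega>(2) dual_lact_apply dual_ract_apply blinfun.bilinear_simps)
  ultimately show ?thesis by blast
qed

section \<open>Matrix units\<close>

definition mat_unit :: "'n \<Rightarrow> 'n \<Rightarrow> 'a \<Rightarrow> ('a::complex_banach_algebra, 'n::finite) sqmat" where
  "mat_unit i j a = Sqmat (\<chi> k l. if k = i \<and> l = j then a else 0)"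

lemma entries_mat_unit: "entries (mat_unit i j a) $ k $ l = (if k = i \<and> l = j then a else 0)"
  by (simp add: mat_unit_def Sqmat_inverse)

lemma entries_scaleC: "entries (c *\<^sub>C A) $ i $ j = c *\<^sub>C (entries A $ i $ j)"
  by (simp add: scaleC_sqmat.rep_eq)

lemma scaleC_zero_right: "c *\<^sub>C (0::'a::complex_banach_algebra) = 0"
  using norm_scaleC[of c "0::'a"] by simp

lemma mat_unit_mult:
  "mat_unit i j a * mat_unit k l b = (if j = k then mat_unit i l (a * b) else 0)"
  by (auto simp: sqmat_eq_iff entries_simps entries_mat_unit if_distrib[of "\<lambda>x. x * _"]
      if_distrib[of "\<lambda>x. _ * x"] cong: if_cong)

lemma mat_unit_simps:
  "mat_unit i j 0 = 0" "mat_unit i j (- a) = - mat_unit i j a"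
  "mat_unit i j (a + b) = mat_unit i j a + mat_unit i j b"
  "mat_unit i j (r *\<^sub>R a) = r *\<^sub>R mat_unit i j a"
  "mat_unit i j (c *\<^sub>C a) = c *\<^sub>C mat_unit i j a"
  by (auto simp: sqmat_eq_iff entries_simps entries_mat_unit entries_scaleC scaleC_zero_right)

lemma bounded_linear_mat_unit: "bounded_linear (mat_unit i j)"
proof (rule bounded_linear_intro[where K = 1])
  fix a :: 'a
  have "norm (mat_unit i j a) \<le> (\<Sum>k\<in>UNIV. \<Sum>l\<in>UNIV. norm (entries (mat_unit i j a) $ k $ l))"
    by (rule norm_sqmat_le_sum)
  also have "\<dots> = (\<Sum>k\<in>UNIV. \<Sum>l\<in>UNIV. if l = j then (if k = i then norm a else 0) else 0)"
    by (intro sum.cong refl) (simp add: entries_mat_unit)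
  also have "\<dots> = norm a" by simp
  finally show "norm (mat_unit i j a) \<le> norm a * 1" by simp
qed (simp_all add: mat_unit_simps)

lemma sqmat_decompose: "X = (\<Sum>i\<in>UNIV. \<Sum>j\<in>UNIV. mat_unit i j (entries X $ i $ j))"
proof -
  have entries_sum: "entries (sum f S) $ k $ l = (\<Sum>i\<in>S. entries (f i) $ k $ l)"
    if "finite S" for f :: "'b \<Rightarrow> ('a, 'b) sqmat" and S k l
    using that by induction (simp_all add: entries_simps)
  have "entries (\<Sum>i\<in>UNIV. \<Sum>j\<in>UNIV. mat_unit i j (entries X $ i $ j)) $ k $ l
    = (\<Sum>i\<in>UNIV. \<Sum>j\<in>UNIV. if j = l then (if i = k then entries X $ i $ j else 0) else 0)" for k l
    unfolding entries_sum[OF finite] by (intro sum.cong refl) (auto simp: entries_mat_unit)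
  then show ?thesis
    by (simp add: sqmat_eq_iff)
qed

lemma cbilinear_form_eqI_mat_units:
  fixes \<phi> \<psi> :: "('a::complex_banach_algebra, 'n::finite) sqmat \<Rightarrow> ('a, 'n) sqmat \<Rightarrow> complex"
  assumes "cbilinear_form \<phi>" "cbilinear_form \<psi>"
    and eq: "\<And>i j k l a b. \<phi> (mat_unit i j a) (mat_unit k l b) = \<psi> (mat_unit i j a) (mat_unit k l b)"
  shows "\<phi> X Y = \<psi> X Y"
proof -
  interpret f: cbilinear_form \<phi> by fact
  interpret g: cbilinear_form \<psi> by fact
  show ?thesis
    by (subst (1 2) sqmat_decompose[of X], subst (1 2) sqmat_decompose[of Y])
      (simp add: f.sum_left f.sum_right g.sum_left g.sum_right eq)
qed

lemma entrywise_functional: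
  fixes f :: "'n::finite \<Rightarrow> 'n \<Rightarrow> ('a::complex_banach_algebra \<Rightarrow>\<^sub>L complex)"
  assumes f: "\<And>i j. f i j \<in> cdual"
  shows "\<exists>\<omega>\<in>cdual. \<forall>i j a. blinfun_apply \<omega> (mat_unit i j a) = blinfun_apply (f i j) a"
proof -
  have "\<exists>\<omega>\<in>cdual. \<forall>X. blinfun_apply \<omega> X
      = (\<Sum>i\<in>UNIV. \<Sum>j\<in>UNIV. blinfun_apply (f i j) (entries X $ i $ j))"
  proof (rule cdual_exI)
    fix X :: "('a, 'n) sqmat"
    have "norm (\<Sum>i\<in>UNIV. \<Sum>j\<in>UNIV. blinfun_apply (f i j) (entries X $ i $ j))
      \<le> (\<Sum>i\<in>UNIV. \<Sum>j\<in>UNIV. norm (f i j) * norm X)"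
      by (intro sum_norm_le order_trans[OF norm_blinfun] mult_left_mono norm_entries_le norm_ge_zero)
    then show "norm (\<Sum>i\<in>UNIV. \<Sum>j\<in>UNIV. blinfun_apply (f i j) (entries X $ i $ j))
      \<le> norm X * (\<Sum>i\<in>UNIV. \<Sum>j\<in>UNIV. norm (f i j))"
      by (simp add: sum_distrib_left mult.commute)
  qed (simp_all add: entries_simps entries_scaleC cdualE[OF f] sum.distrib sum_distrib_left)
  then obtain \<omega> where \<omega>: "\<omega> \<in> cdual" "\<And>X. blinfun_apply \<omega> X
      = (\<Sum>i\<in>UNIV. \<Sum>j\<in>UNIV. blinfun_apply (f i j) (entries X $ i $ j))"
    by blast
  have "blinfun_apply \<omega> (mat_unit k l a) = blinfun_apply (f k l) a" for k l a
  proof -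
    have "blinfun_apply \<omega> (mat_unit k l a)
      = (\<Sum>i\<in>UNIV. \<Sum>j\<in>UNIV. if j = l then (if i = k then blinfun_apply (f i j) a else 0) else 0)"
      unfolding \<omega>(2) by (intro sum.cong refl) (auto simp: entries_mat_unit blinfun.zero_right)
    then show ?thesis by simp
  qed
  with \<omega>(1) show ?thesis by blast
qed

section \<open>Forms on matrices vanishing on commuting pairs\<close>

lemma cbilinear_form_entry:
  assumes "cbilinear_form \<phi>"
  shows "cbilinear_form (\<lambda>a b. \<phi> (mat_unit i j a) (mat_unit k l b))"
  by (rule cbilinear_form.cbilinear_form_compose[OF assms])
    (simp_all add: bounded_linear_mat_unit mat_unit_simps)

text \<open>The sum \<open>a e\<^sub>i\<^sub>j + a b e\<^sub>i\<^sub>k\<close> annihilates \<open>b c e\<^sub>j\<^sub>l - c e\<^sub>k\<^sub>l\<close> from both sides: in one order the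
  products \<open>a b c e\<^sub>i\<^sub>l\<close> cancel, in the other order all products vanish because \<open>i \<noteq> l\<close>.\<close>

lemma off_diagonal_balance:
  fixes \<phi> :: "('a::complex_banach_algebra, 'n::finite) sqmat \<Rightarrow> ('a, 'n) sqmat \<Rightarrow> complex"
  assumes "cbilinear_form \<phi>"
    and comm: "\<And>X Y. X * Y = Y * X \<Longrightarrow> \<phi> X Y = 0"
    and "i \<noteq> l" "j \<noteq> k"
  shows "\<phi> (mat_unit i j a) (mat_unit j l (b * c)) = \<phi> (mat_unit i k (a * b)) (mat_unit k l c)"
proof -
  interpret cbilinear_form \<phi> by fact
  have "\<phi> (mat_unit i j a + mat_unit i k (a * b)) (mat_unit j l (b * c) - mat_unit k l c) = 0"
    using assms(3,4)
    by (intro comm) (simp add: mat_unit_mult algebra_simps)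
  moreover have "\<phi> (mat_unit i j a) (mat_unit k l c) = 0"
    "\<phi> (mat_unit i k (a * b)) (mat_unit j l (b * c)) = 0"
    using assms(3,4) by (auto intro!: comm simp: mat_unit_mult)
  ultimately show ?thesis
    by (simp add: add_left diff_right)
qed

lemma (in bounded_approximate_unit) off_diagonal_functional:
  fixes \<phi> :: "('a, 'n::finite) sqmat \<Rightarrow> ('a, 'n) sqmat \<Rightarrow> complex"
  assumes form: "cbilinear_form \<phi>"
    and comm: "\<And>X Y. X * Y = Y * X \<Longrightarrow> \<phi> X Y = 0"
    and "i \<noteq> l"
  shows "\<exists>f\<in>cdual. \<forall>j a c. \<phi> (mat_unit i j a) (mat_unit j l c) = blinfun_apply f (a * c)"
proof -
  define P where "P j a c = \<phi> (mat_unit i j a) (mat_unit j l c)" for j a c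
  have P: "cbilinear_form (P j)" for j
    unfolding P_def by (rule cbilinear_form_entry[OF form])
  have move: "P j a (b * c) = P k (a * b) c" if "j \<noteq> k" for j k a b c
    unfolding P_def by (rule off_diagonal_balance[OF form comm \<open>i \<noteq> l\<close> that])
  \<comment> \<open>Letting \<open>b\<close> in \<open>move\<close> tend to a unit shows that the inner index is immaterial.\<close>
  have indep: "P j a c = P l a c" for j a c
  proof (cases "j = l")
    case False
    interpret j: cbilinear_form "P j" by (rule P)
    interpret l: cbilinear_form "P l" by (rule P)
    have "((\<lambda>d. P j a (e d * c) - P l (a * e d) c) \<longlongrightarrow> P j a c - P l a c) F"
      by (intro tendsto_intros j.tendsto l.tendsto left_unit right_unit)
    then have "P j a c - P l a c = 0"
      by (rule limit_of_constant[where g = "\<lambda>b. P j a (b * c) - P l (a * b) c"])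
        (simp add: move[OF False])
    then show ?thesis by simp
  qed simp
  have "P l (a * b) c = P l a (b * c)" for a b c
    using move[OF \<open>i \<noteq> l\<close>, of a b c] indep[of i a "b * c"] by simp
  then obtain f where "f \<in> cdual" "\<And>a c. P l a c = blinfun_apply f (a * c)"
    using balanced_form_factors[OF P] by blast
  then show ?thesis
    unfolding P_def[symmetric] using indep by metis
qed

text \<open>Over a unital algebra, \<open>X\<close> is the column \<open>(1, d)\<close> times \<open>a\<close> times the row \<open>(1, b)\<close>, and \<open>Y\<close> is
  the column \<open>(b, -1)\<close> times \<open>c\<close> times the row \<open>(d, -1)\<close>. The columns of \<open>X\<close> and the rows of \<open>Y\<close> are
  placed at \<open>l\<close> and \<open>l'\<close>, and the rows of \<open>X\<close> and the columns of \<open>Y\<close> at \<open>i\<close> and \<open>i'\<close>. Since row times column is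
  zero both ways, \<open>X * Y = Y * X = 0\<close>. The entries of \<open>X\<close> and \<open>Y\<close> make sense without a unit.\<close>

lemma rank_one_relation:
  fixes \<phi> :: "('a::complex_banach_algebra, 'n::finite) sqmat \<Rightarrow> ('a, 'n) sqmat \<Rightarrow> complex"
  assumes "cbilinear_form \<phi>"
    and comm: "\<And>X Y. X * Y = Y * X \<Longrightarrow> \<phi> X Y = 0"
    and supp: "\<And>i j k l a b. \<not> (j = k \<and> l = i) \<Longrightarrow> \<phi> (mat_unit i j a) (mat_unit k l b) = 0"
    and "i \<noteq> i'" "l \<noteq> l'"
  defines "G \<equiv> \<lambda>i j a b. \<phi> (mat_unit i j a) (mat_unit j i b)"
  shows "G i l a (b * c * d) - G i l' (a * b) (c * d) - G i' l (d * a) (b * c)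
    + G i' l' (d * a * b) c = 0"
proof -
  interpret cbilinear_form \<phi> by fact
  let ?X = "mat_unit i l a + mat_unit i l' (a * b) + mat_unit i' l (d * a) + mat_unit i' l' (d * a * b)"
  let ?Y = "mat_unit l i (b * c * d) - mat_unit l' i (c * d) - mat_unit l i' (b * c) + mat_unit l' i' c"
  have "?X * ?Y = 0" "?Y * ?X = 0"
    using assms(4,5) by (simp_all add: algebra_simps mat_unit_mult)
  then have "\<phi> ?X ?Y = 0"
    by (intro comm) simp
  with assms(4,5) show ?thesis
    by (simp add: G_def add_left add_right diff_right supp)
qed

lemma (in bounded_approximate_unit) diagonal_functionals:
  fixes \<phi> :: "('a, 'n::finite) sqmat \<Rightarrow> ('a, 'n) sqmat \<Rightarrow> complex"
  assumes form: "cbilinear_form \<phi>"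
    and comm: "\<And>X Y. X * Y = Y * X \<Longrightarrow> \<phi> X Y = 0"
    and supp: "\<And>i j k l a b. \<not> (j = k \<and> l = i) \<Longrightarrow> \<phi> (mat_unit i j a) (mat_unit k l b) = 0"
    and amenable: "cyclically_amenable TYPE('a)"
    and card: "CARD('n) \<ge> 2"
  obtains f where "\<And>i. f i \<in> cdual"
    and "\<And>i j a b. \<phi> (mat_unit i j a) (mat_unit j i b)
      = blinfun_apply (f i) (a * b) - blinfun_apply (f j) (b * a)"
proof -
  define G where "G i j a b = \<phi> (mat_unit i j a) (mat_unit j i b)" for i j a b
  interpret cbilinear_form \<phi> by fact
  have G: "cbilinear_form (G i j)" for i j
    unfolding G_def by (rule cbilinear_form_entry[OF form])
  have skew: "G i j a b = - G j i b a" for i j a b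
    unfolding G_def by (rule skew_if_alternating) (simp add: comm)
  have rel: "G i l a (b * c * d) - G i l' (a * b) (c * d) - G i' l (d * a) (b * c)
    + G i' l' (d * a * b) c = 0" if "i \<noteq> i'" "l \<noteq> l'" for i i' l l' a b c d
    unfolding G_def by (rule rank_one_relation[OF form comm supp that])
  obtain n m :: 'n where m: "m \<noteq> n"
    using card by (metis One_nat_def Suc_1 card_le_Suc0_iff_eq finite not_less_eq_eq)
  have square: "G n n a (a * a) = 0" for a
    unfolding G_def by (intro comm) (simp add: mat_unit_mult mult.assoc)
  \<comment> \<open>Here \<open>rel\<close> is taken at \<open>i\<close> and \<open>n\<close> in both pairs of indices, so the forms are
    \<open>G i i\<close>, \<open>G i n\<close>, \<open>G n i\<close>, \<open>G n n\<close>.\<close>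
  note coupling = four_forms_coupling[OF G G G G skew skew rel]
  have "G n n (a * b) c + G n n (b * c) a + G n n (c * a) b = 0" for a b c
    by (rule cyclic_derivation_identity[OF G skew square coupling(2)[OF m m]])
  then obtain h where h: "h \<in> cdual" "\<And>a b. G n n a b = blinfun_apply h (a * b) - blinfun_apply h (b * a)"
    using cyclically_amenable_form[OF amenable G skew] by metis
  \<comment> \<open>The lack of balance of \<open>G i n\<close> is that of \<open>G n n\<close>, and hence that of \<open>- h (b * a)\<close>.\<close>
  have "\<exists>g\<in>cdual. \<forall>a b. G i n a b + blinfun_apply h (b * a) = blinfun_apply g (a * b)" if "i \<noteq> n" for i
  proof (rule balanced_form_factors)
    show "cbilinear_form (\<lambda>a b. G i n a b + blinfun_apply h (b * a))"
      by (intro cbilinear_form.cbilinear_form_plus G cbilinear_form_functional_mult h)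
    show "G i n (a * b) c + blinfun_apply h (c * (a * b)) = G i n a (b * c) + blinfun_apply h (b * c * a)" for a b c
      using coupling(1)[OF that that, of a b c] by (simp add: h(2) mult.assoc algebra_simps)
  qed
  then have "\<forall>i. \<exists>g\<in>cdual. (i = n \<longrightarrow> g = h) \<and>
      (\<forall>a b. G i n a b = blinfun_apply g (a * b) - blinfun_apply h (b * a))"
    using h by (metis add_diff_cancel_right')
  then obtain f where f: "\<And>i. f i \<in> cdual" "f n = h"
    "\<And>i a b. G i n a b = blinfun_apply (f i) (a * b) - blinfun_apply h (b * a)"
    by metis
  have "G i j a b = blinfun_apply (f i) (a * b) - blinfun_apply (f j) (b * a)" for i j a b
  proof -
    have "G i j a b - G i n a b - G n j a b + G n n a b = 0"
    proof (cases "i = n \<or> j = n")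
      case True
      then show ?thesis by auto
    next
      case False
      then show ?thesis
        by (intro four_forms_limits(2)[OF G G G G rel]) auto
    qed
    then show ?thesis
      using skew[of n j a b] f(3)[of i a b] f(3)[of j b a] h(2)[of a b] by algebra
  qed
  with f(1) show thesis
    using that[of f] unfolding G_def by blast
qed

theorem theorem4p4:
  fixes I :: "'i set" and r :: "'i rel" and e :: "'i \<Rightarrow> 'a::complex_banach_algebra"
  assumes "cyclically_amenable TYPE('a)"
    and "bounded_approximate_identity I r e"
    and "CARD('n::finite) \<ge> 2"
  shows "zero_Lie_product_determined TYPE(('a, 'n) sqmat)"
  unfolding zero_Lie_product_determined_def
proof (intro allI impI, elim conjE)
  have directed: "directed_on I r"
    using assms(2) by (simp add: bounded_approximate_identity_def)
  obtain B where B: "\<And>i. i \<in> I \<Longrightarrow> norm (e i) \<le> B"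
    using assms(2) by (auto simp: bounded_approximate_identity_def bounded_iff)
  have refl: "(i, i) \<in> r" if "i \<in> I" for i
    using directed that by (auto simp: directed_on_def preorder_on_def refl_on_def)
  interpret bounded_approximate_unit "tails I r" e B
  proof
    show "tails I r \<noteq> bot"
      using refl by (auto simp: trivial_limit_def eventually_tails[OF directed])
    show "\<forall>\<^sub>F i in tails I r. norm (e i) \<le> B"
      using directed B refl by (auto simp: eventually_tails[OF directed] directed_on_def)
    show "((\<lambda>i. e i * a) \<longlongrightarrow> a) (tails I r)" "((\<lambda>i. a * e i) \<longlongrightarrow> a) (tails I r)" for a
      using assms(2) by (simp_all add: bounded_approximate_identity_def)
  qed
  fix \<phi> :: "('a, 'n) sqmat \<Rightarrow> ('a, 'n) sqmat \<Rightarrow> complex"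
  assume functional: "\<forall>a. clinear_functional (\<phi> a)" "\<forall>b. clinear_functional (\<lambda>a. \<phi> a b)"
    and cont: "continuous_on UNIV (\<lambda>(a, b). \<phi> a b)"
    and "\<forall>a b. a * b = b * a \<longrightarrow> \<phi> a b = 0"
  then have comm: "\<phi> X Y = 0" if "X * Y = Y * X" for X Y
    using that by blast
  have form: "cbilinear_form \<phi>"
    using functional cont by (intro cbilinear_formI) auto
  have skew: "\<phi> X Y = - \<phi> Y X" for X Y
    by (rule cbilinear_form.skew_if_alternating[OF form]) (simp add: comm)
  \<comment> \<open>The functionals \<open>f i l\<close> handle the entries off the diagonal; \<open>f i i = 0\<close> leaves the diagonal to \<open>g\<close>.\<close>
  have "0 \<in> (cdual :: ('a \<Rightarrow>\<^sub>L complex) set)"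
    by (simp add: cdual_def clinear_functional_iff)
  then have "\<forall>i l. \<exists>f\<in>cdual. if i = l then f = 0
      else \<forall>j a b. \<phi> (mat_unit i j a) (mat_unit j l b) = blinfun_apply f (a * b)"
    using off_diagonal_functional[OF form comm] by (metis (full_types))
  then obtain f where f: "\<And>i l. f i l \<in> cdual" "\<And>i. f i i = 0"
    "\<And>i j l a b. i \<noteq> l \<Longrightarrow> \<phi> (mat_unit i j a) (mat_unit j l b) = blinfun_apply (f i l) (a * b)"
    by metis
  obtain \<omega>\<^sub>1 where \<omega>\<^sub>1: "\<omega>\<^sub>1 \<in> cdual"
    "\<And>i j a. blinfun_apply \<omega>\<^sub>1 (mat_unit i j a) = blinfun_apply (f i j) a"
    using entrywise_functional[of f] f(1) by blast
  define \<psi> where "\<psi> X Y = \<phi> X Y + (blinfun_apply \<omega>\<^sub>1 (Y * X) + - blinfun_apply \<omega>\<^sub>1 (X * Y))" for X Y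
  have \<psi>_form: "cbilinear_form \<psi>"
    unfolding \<psi>_def
    by (intro cbilinear_form.cbilinear_form_plus cbilinear_form_uminus form
        cbilinear_form_functional_mult[OF \<omega>\<^sub>1(1)])
  have \<psi>_comm: "\<psi> X Y = 0" if "X * Y = Y * X" for X Y
    using comm[OF that] that by (simp add: \<psi>_def)
  have \<psi>_supp: "\<psi> (mat_unit i j a) (mat_unit k l b) = 0" if off: "\<not> (j = k \<and> l = i)" for i j k l a b
  proof -
    consider "j = k" "l \<noteq> i" | "j \<noteq> k" "l = i" | "j \<noteq> k" "l \<noteq> i"
      using off by blast
    then show ?thesis
    proof cases
      case 1
      then show ?thesis
        by (simp add: \<psi>_def mat_unit_mult \<omega>\<^sub>1(2) f(3) blinfun.zero_right)
    next
      case 2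
      then show ?thesis
        using skew[of "mat_unit i j a" "mat_unit k l b"]
        by (simp add: \<psi>_def mat_unit_mult \<omega>\<^sub>1(2) f(3) blinfun.zero_right)
    next
      case 3
      then show ?thesis
        by (intro \<psi>_comm) (simp add: mat_unit_mult)
    qed
  qed
  obtain g where g: "\<And>i. g i \<in> cdual"
    "\<And>i j a b. \<psi> (mat_unit i j a) (mat_unit j i b)
      = blinfun_apply (g i) (a * b) - blinfun_apply (g j) (b * a)"
    using diagonal_functionals[OF \<psi>_form \<psi>_comm \<psi>_supp assms(1,3)] by blast
  have "(if i = j then g i else 0) \<in> cdual" for i j
    using g(1) \<open>0 \<in> cdual\<close> by simp
  from entrywise_functional[of "\<lambda>i j. if i = j then g i else 0", OF this]
  obtain \<omega>\<^sub>2 where \<omega>\<^sub>2: "\<omega>\<^sub>2 \<in> cdual"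
    "\<And>i j a. blinfun_apply \<omega>\<^sub>2 (mat_unit i j a) = (if i = j then blinfun_apply (g i) a else 0)"
    by (force simp: if_distrib[of blinfun_apply])
  have "\<psi> X Y = blinfun_apply \<omega>\<^sub>2 (X * Y) + - blinfun_apply \<omega>\<^sub>2 (Y * X)" for X Y
  proof (rule cbilinear_form_eqI_mat_units[OF \<psi>_form])
    show "cbilinear_form (\<lambda>X Y. blinfun_apply \<omega>\<^sub>2 (X * Y) + - blinfun_apply \<omega>\<^sub>2 (Y * X))"
      by (intro cbilinear_form.cbilinear_form_plus cbilinear_form_uminus
          cbilinear_form_functional_mult[OF \<omega>\<^sub>2(1)])
    show "\<psi> (mat_unit i j a) (mat_unit k l b)
      = blinfun_apply \<omega>\<^sub>2 (mat_unit i j a * mat_unit k l b)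
        + - blinfun_apply \<omega>\<^sub>2 (mat_unit k l b * mat_unit i j a)" for i j k l a b
      by (cases "j = k \<and> l = i") (auto simp: g(2) \<psi>_supp mat_unit_mult \<omega>\<^sub>2(2) blinfun.zero_right)
  qed
  note \<psi>_eq = this
  have "\<phi> X Y = blinfun_apply (\<omega>\<^sub>1 + \<omega>\<^sub>2) (X * Y - Y * X)" for X Y
    using \<psi>_eq[of X Y] unfolding \<psi>_def blinfun.diff_right blinfun.add_left by algebra
  moreover have "\<omega>\<^sub>1 + \<omega>\<^sub>2 \<in> cdual"
    using \<omega>\<^sub>1(1) \<omega>\<^sub>2(1) by (simp add: cdual_def clinear_functional_iff blinfun.add_left distrib_left)
  ultimately show "\<exists>\<omega>\<in>cdual. \<forall>a b. \<phi> a b = blinfun_apply \<omega> (a * b - b * a)"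
    by blast
qed

end
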